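(* Let $n\ge 0$ be an integer. Let $\mathcal{A}_n$ be the set of pairs $(D,i)$ where $D$ is a Barrucand $n$-deal and $i$ is an integer with $1\le i\le \binom{n+m}{m}$, where $m$ is the number of cards in red's hand in $D$ (equivalently, the number of denominations in the deal $D$). Then for every integer $k$ with $0\le k\le n$, the number of pairs $(D,i)\in\mathcal{A}_n$ such that red's hand in $D$ contains exactly $k$ distinct denominations is $$\binom{n}{k}^{2}\binom{n+k}{k}^{2}.$$ That is, the right side of the identity $\sum_{k=0}^{n}\binom{n}{k}\binom{n+k}{k}\sum_{j=0}^{k}\binom{k}{j}^{3}=\sum_{k=0}^{n}\binom{n}{k}^{2}\binom{n+k}{k}^{2}$ counts $\mathcal{A}_n$ by the number $k$ of distinct denominations in the red player's hand in the associated deal.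
   Context: A Barrucand $n$-deal is formed as follows. Start with a deck of $3n$ cards, $n$ each colored red, green and blue, with one card of each color in each denomination $1,\dots,n$. Choose an arbitrary subset of the denominations (the denominations "in the deal") and deal all cards of the chosen denominations into three equal-size hands to three players designated red, green and blue, in such a way that no player receives a card of her own color. A deal is determined by the set of cards in each hand. *)

theory Defs
  imports Main "HOL.Binomial" "HOL-Library.Disjoint_Sets"
begin

datatype color = Red | Green | Blue

type_synonym playing_card = "color \<times> nat"  \<comment> \<open>color and denomination\<close>

text \<open>The players are named by the colors too, and a deal is identified with the map sending each
  player to her hand. The set \<open>S\<close> of denominations in the deal is determined by the hands, hence is
  not recorded separately.\<close>

definition barrucand_deals :: "nat \<Rightarrow> (color \<Rightarrow> playing_card set) set" where
  "barrucand_deals n =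
    {D. \<exists>S \<subseteq> {1..n}.
          (\<Union>p. D p) = UNIV \<times> S \<and>
          disjoint_family D \<and>
          (\<forall>p q. card (D p) = card (D q)) \<and>
          (\<forall>p. \<forall>c \<in> D p. fst c \<noteq> p)}"

definition deal_pairs :: "nat \<Rightarrow> ((color \<Rightarrow> playing_card set) \<times> nat) set" where
  "deal_pairs n =
    {(D, i). D \<in> barrucand_deals n \<and>
             1 \<le> i \<and> i \<le> (n + card (D Red)) choose card (D Red)}"

definition denominations :: "playing_card set \<Rightarrow> nat set" where
  "denominations H = snd ` H"

end

theory Submission
  imports Defs
begin

text \<open>
  Fix \<open>k\<close> and sort the deals in which red sees \<open>k\<close> denominations by three sets: the set \<open>K\<close> of
  denominations in red's hand, the set \<open>T\<close> of denominations in the deal that red misses, and the set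
  \<open>I\<close> of denominations of which red holds both cards open to her.  Red holds \<open>k + card I\<close> cards,
  and as many as there are denominations in the deal, namely \<open>k + card T\<close>; hence
  \<open>card I = card T\<close>.

  Given \<open>K\<close>, \<open>T\<close>, \<open>I\<close>, the deal is determined by green's hand.  Green must hold the \<open>card T\<close> blue cards
  of \<open>T\<close> and cannot hold the blue cards of \<open>I\<close>.  Her other \<open>k\<close> cards can be chosen freely among the
  red cards of \<open>K \<union> T\<close> and the blue cards of \<open>K - I\<close>, which are \<open>2 * k\<close> cards in all.
  The number of choices, \<open>2 * k choose k\<close>, does not depend on \<open>K\<close>, \<open>T\<close>, \<open>I\<close>.  With \<open>t = card T\<close> the number of
  pairs is therefore
  \[ \binom{n}{k}\binom{2k}{k}\sum_t \binom{n-k}{t}\binom{k}{t}\binom{n+k+t}{k+t}. \]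
  Reordering the choice of nested subsets (\<open>central_binomial_exchange\<close>) turns the sum, together
  with the factor \<open>2 * k choose k\<close>, into
  \[ \binom{n+k}{k}\sum_t \binom{n-k}{t}\binom{2k}{k-t}\binom{n+k+t}{t}, \]
  and the last sum is a case of the Pfaff--Saalschuetz summation, evaluated
  by three applications of Vandermonde's convolution (\<open>saalschuetz_binomial\<close>).  The value
  is \<open>(n choose k) * (n + k choose k)\<close>, which gives the claim.  The correspondence of deals with
  choices of \<open>K\<close>, \<open>T\<close>, \<open>I\<close> and green's free cards is \<open>bij_betw_deal_of\<close>.
\<close>

section \<open>Binomial sums\<close>

text \<open>Vandermonde's convolution for the pairs of a \<open>j\<close>-subset of the first part
  and an \<open>r\<close>-subset of the whole that contains it.\<close>

lemma vandermonde_absorb: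
  fixes p q r j :: nat
  assumes "j \<le> r" "j \<le> p"
  shows "(\<Sum>i\<le>r. (p choose i) * (i choose j) * (q choose (r - i)))
          = (p choose j) * ((p - j + q) choose (r - j))"
proof -
  have "(\<Sum>i\<le>r. (p choose i) * (i choose j) * (q choose (r - i)))
      = (\<Sum>i=j..r. (p choose i) * (i choose j) * (q choose (r - i)))"
    by (rule sum.mono_neutral_right) auto
  also have "\<dots> = (\<Sum>i=j..r. (p choose j) * ((p - j) choose (i - j)) * (q choose (r - i)))"
  proof (rule sum.cong[OF refl])
    fix i assume i: "i \<in> {j..r}"
    show "(p choose i) * (i choose j) * (q choose (r - i))
        = (p choose j) * ((p - j) choose (i - j)) * (q choose (r - i))"
    proof (cases "i \<le> p")
      case True
      then show ?thesis using i choose_mult[of j i p] by simp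
    next
      case False
      then show ?thesis
        using i assms by (simp add: binomial_eq_0)
    qed
  qed
  also have "\<dots> = (\<Sum>i\<le>r - j. (p choose j) * (((p - j) choose i) * (q choose (r - j - i))))"
    by (rule sum.reindex_bij_witness[of _ "\<lambda>i. i + j" "\<lambda>i. i - j"]) (use assms in auto)
  also have "\<dots> = (p choose j) * ((p - j + q) choose (r - j))"
    by (simp only: sum_distrib_left[symmetric] vandermonde)
  finally show ?thesis .
qed

text \<open>Expanding the last factor over the parts \<open>n + k\<close> and \<open>i\<close> and exchanging the sums leaves
  \<open>(n + k choose k) * (\<Sum>j. (n - k choose j) * (k choose j))\<close>.\<close>

lemma saalschuetz_binomial:
  fixes n k :: nat
  assumes "k \<le> n"
  shows "(\<Sum>i\<le>k. ((n - k) choose i) * ((2 * k) choose (k - i)) * ((n + k + i) choose i))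
          = (n choose k) * ((n + k) choose k)"
proof -
  have expand: "(n + k + i) choose i = (\<Sum>j\<le>k. (i choose j) * ((n + k) choose j))" if "i \<le> k" for i
  proof -
    have "(n + k + i) choose i = (\<Sum>j\<le>i. ((n + k) choose j) * (i choose (i - j)))"
      by (rule vandermonde[symmetric])
    also have "\<dots> = (\<Sum>j\<le>i. (i choose j) * ((n + k) choose j))"
      by (intro sum.cong refl) (auto simp: binomial_symmetric[symmetric])
    also have "\<dots> = (\<Sum>j\<le>k. (i choose j) * ((n + k) choose j))"
      by (rule sum.mono_neutral_left) (use that in auto)
    finally show ?thesis .
  qed
  have "(\<Sum>i\<le>k. ((n - k) choose i) * ((2 * k) choose (k - i)) * ((n + k + i) choose i))
      = (\<Sum>i\<le>k. \<Sum>j\<le>k. ((n + k) choose j) *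
            (((n - k) choose i) * (i choose j) * ((2 * k) choose (k - i))))"
    by (intro sum.cong refl) (simp add: expand sum_distrib_left mult_ac)
  also have "\<dots> = (\<Sum>j\<le>k. ((n + k) choose j) *
            (\<Sum>i\<le>k. ((n - k) choose i) * (i choose j) * ((2 * k) choose (k - i))))"
    by (subst sum.swap) (simp add: sum_distrib_left)
  also have "\<dots> = (\<Sum>j\<le>k. ((n + k) choose k) * (((n - k) choose j) * (k choose (k - j))))"
  proof (rule sum.cong[OF refl])
    fix j assume j: "j \<in> {..k}"
    show "((n + k) choose j) *
            (\<Sum>i\<le>k. ((n - k) choose i) * (i choose j) * ((2 * k) choose (k - i)))
        = ((n + k) choose k) * (((n - k) choose j) * (k choose (k - j)))"
    proof (cases "j \<le> n - k")
      case True
      have "((n + k) choose k) * (k choose j) = ((n + k) choose j) * ((n + k - j) choose (k - j))"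
        using j by (intro choose_mult) auto
      moreover have "n - k - j + 2 * k = n + k - j"
        using True assms by simp
      ultimately show ?thesis
        using True j by (simp add: vandermonde_absorb binomial_symmetric[symmetric])
    next
      case False
      then have "((n - k) choose i) * (i choose j) = 0" for i
        by (cases "i \<le> n - k") (auto simp: binomial_eq_0)
      then have "(\<Sum>i\<le>k. ((n - k) choose i) * (i choose j) * ((2 * k) choose (k - i))) = 0"
        by (simp only: mult_zero_left sum.neutral_const)
      with False show ?thesis by (simp add: binomial_eq_0)
    qed
  qed
  also have "\<dots> = ((n + k) choose k) * ((n - k + k) choose k)"
    by (simp only: sum_distrib_left[symmetric] vandermonde)
  finally show ?thesis using assms by (simp add: mult.commute)
qed

text \<open>The factor \<open>2 * k choose k\<close>, which is constant in \<open>i\<close>, is traded for \<open>n + k choose k\<close>, so that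
  what remains has the form of \<open>saalschuetz_binomial\<close>.  Both steps count chains of two nested
  subsets: first those with \<open>k - i \<le> k \<le> 2 * k\<close> elements, then those with
  \<open>i \<le> k + i \<le> n + k + i\<close>.\<close>

lemma central_binomial_exchange:
  fixes n k i :: nat
  assumes "i \<le> k"
  shows "((2 * k) choose k) * (k choose i) * ((n + k + i) choose (k + i))
       = ((n + k) choose k) * ((2 * k) choose (k - i)) * ((n + k + i) choose i)"
proof -
  have "((2 * k) choose k) * (k choose i) = ((2 * k) choose k) * (k choose (k - i))"
    using assms by (simp add: binomial_symmetric[symmetric])
  also have "\<dots> = ((2 * k) choose (k - i)) * ((2 * k - (k - i)) choose (k - (k - i)))"
    by (rule choose_mult) auto
  also have "\<dots> = ((2 * k) choose (k - i)) * ((k + i) choose i)"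
    using assms by (simp add: mult_2)
  finally have "((2 * k) choose k) * (k choose i) * ((n + k + i) choose (k + i))
      = ((2 * k) choose (k - i)) * (((n + k + i) choose (k + i)) * ((k + i) choose i))"
    by (simp add: mult_ac)
  also have "((n + k + i) choose (k + i)) * ((k + i) choose i)
      = ((n + k + i) choose i) * ((n + k) choose k)"
    using choose_mult[of i "k + i" "n + k + i"] by simp
  finally show ?thesis
    by (simp add: mult_ac)
qed

lemma sum_Pow_card:
  fixes f :: "nat \<Rightarrow> nat"
  assumes "finite A"
  shows "(\<Sum>T\<in>Pow A. f (card T)) = (\<Sum>t\<le>card A. (card A choose t) * f t)"
proof -
  have "(\<Sum>T\<in>Pow A. f (card T)) = (\<Sum>t\<le>card A. \<Sum>T\<in>{T\<in>Pow A. card T = t}. f (card T))"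
    by (rule sum.group[symmetric]) (use assms card_mono in auto)
  also have "\<dots> = (\<Sum>t\<le>card A. (card A choose t) * f t)"
    by (intro sum.cong refl) (use n_subsets[OF assms] in simp)
  finally show ?thesis .
qed

section \<open>The structure of a deal\<close>

lemma UNIV_color: "UNIV = {Red, Green, Blue}"
  using color.exhaust by auto

lemma ex_color: "(\<exists>p. P p) \<longleftrightarrow> P Red \<or> P Green \<or> P Blue"
  by (metis color.exhaust)

lemma all_color: "(\<forall>p. P p) \<longleftrightarrow> P Red \<and> P Green \<and> P Blue"
  by (metis color.exhaust)

lemma sum_card_hands:
  fixes D :: "color \<Rightarrow> playing_card set"
  assumes "(\<Union>p. D p) = UNIV \<times> S" "disjoint_family D" "finite S"
  shows "card (D Red) + card (D Green) + card (D Blue) = 3 * card S"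
proof -
  have "finite (UNIV \<times> S :: playing_card set)"
    using assms(3) by (auto simp: UNIV_color)
  then have "finite (D q)" for q
    using assms(1) by (metis UN_upper finite_subset UNIV_I)
  then have "card (\<Union>q. D q) = (\<Sum>q\<in>UNIV. card (D q))"
    using assms(2) by (intro card_UN_disjoint) (auto simp: disjoint_family_on_def UNIV_color)
  also have "\<dots> = card (D Red) + card (D Green) + card (D Blue)"
    by (simp add: UNIV_color)
  moreover have "card (UNIV :: color set) = 3"
    by (simp add: UNIV_color)
  ultimately show ?thesis
    by (simp only: assms(1) card_cartesian_product)
qed

definition free_green_cards :: "nat set \<Rightarrow> nat set \<Rightarrow> nat set \<Rightarrow> playing_card set" where
  "free_green_cards K T I = {Red} \<times> (K \<union> T) \<union> {Blue} \<times> (K - I)"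

text \<open>In a code \<open>(K, T, I, U)\<close>, red's hand has the denominations \<open>K\<close> and misses the denominations
  \<open>T\<close> of the deal, \<open>I\<close> holds the denominations of which red has two cards, and \<open>U\<close> is green's hand
  without the blue cards of \<open>T\<close>, which she is bound to get.\<close>

definition deal_codes :: "nat \<Rightarrow> nat \<Rightarrow> (nat set \<times> nat set \<times> nat set \<times> playing_card set) set" where
  "deal_codes n k =
    (SIGMA K:{K. K \<subseteq> {1..n} \<and> card K = k}.
     SIGMA T:Pow ({1..n} - K).
     SIGMA I:{I. I \<subseteq> K \<and> card I = card T}.
       {U. U \<subseteq> free_green_cards K T I \<and> card U = k})"

text \<open>A blue card of \<open>K\<close> that green does not take goes to red.  Where green takes it, the green card
  must go to red for the denomination to be in her hand.  Blue gets what is left.\<close>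

fun deal_of :: "nat set \<times> nat set \<times> nat set \<times> playing_card set \<Rightarrow> color \<Rightarrow> playing_card set" where
  "deal_of (K, T, I, U) Red = {Green} \<times> (I \<union> {x. (Blue, x) \<in> U}) \<union> {Blue} \<times> {x\<in>K. (Blue, x) \<notin> U}"
| "deal_of (K, T, I, U) Green = U \<union> {Blue} \<times> T"
| "deal_of (K, T, I, U) Blue =
     {Green} \<times> {x\<in>K \<union> T. x \<notin> I \<and> (Blue, x) \<notin> U} \<union> {Red} \<times> {x\<in>K \<union> T. (Red, x) \<notin> U}"

definition code_of :: "(color \<Rightarrow> playing_card set) \<Rightarrow> nat set \<times> nat set \<times> nat set \<times> playing_card set" where
  "code_of D = (let K = snd ` D Red; T = snd ` (\<Union>p. D p) - K in
     (K, T, {x. (Green, x) \<in> D Red \<and> (Blue, x) \<in> D Red}, D Green - {Blue} \<times> T))"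

text \<open>The hands have equal size because each blue card of \<open>K - I\<close> that green takes is replaced in
  red's hand by the green card of that denomination, so that red has \<open>card K + card I\<close> cards
  whatever \<open>U\<close> is.\<close>

lemma deal_of_in_deals:
  assumes "(K, T, I, U) \<in> deal_codes n k"
  shows "deal_of (K, T, I, U) \<in> barrucand_deals n"
    and "card (deal_of (K, T, I, U) Red) = k + card T"
    and "denominations (deal_of (K, T, I, U) Red) = K"
    and "(\<Union>p. deal_of (K, T, I, U) p) = UNIV \<times> (K \<union> T)"
proof -
  let ?D = "deal_of (K, T, I, U)"
  from assms have K: "K \<subseteq> {1..n}" "card K = k" and T: "T \<subseteq> {1..n}" "T \<inter> K = {}"
    and I: "I \<subseteq> K" "card I = card T" and U: "card U = k"
    "U \<subseteq> {Red} \<times> (K \<union> T) \<union> {Blue} \<times> (K - I)"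
    by (auto simp: deal_codes_def free_green_cards_def)
  have fin: "finite K" "finite T" "finite I"
    using K T I by (meson finite_atLeastAtMost finite_subset)+
  have finU: "finite U"
    using U(2) by (rule finite_subset) (use fin in auto)
  define B where "B = {x. (Blue, x) \<in> U}"
  have B: "B \<subseteq> K - I"
    using U(2) by (auto simp: B_def)
  have finB: "finite B"
    using B fin by (meson finite_Diff finite_subset)
  have union: "(\<Union>p. ?D p) = UNIV \<times> (K \<union> T)"
  proof (rule set_eqI)
    fix c :: playing_card
    obtain a x where c: "c = (a, x)" by (cases c)
    show "c \<in> (\<Union>p. ?D p) \<longleftrightarrow> c \<in> UNIV \<times> (K \<union> T)"
      using U(2) I(1) by (cases a) (auto simp: c ex_color)
  qed
  have disj: "disjoint_family ?D"
    unfolding disjoint_family_on_def UNIV_color using U(2) T(2) I(1) by auto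
  have own: "\<forall>p. \<forall>c \<in> ?D p. fst c \<noteq> p"
    unfolding all_color using U(2) by auto
  have "?D Red = {Green} \<times> (I \<union> B) \<union> {Blue} \<times> (K - B)"
    by (auto simp: B_def)
  also have "card \<dots> = card (I \<union> B) + card (K - B)"
    using fin finB by (subst card_Un_disjoint) (auto simp: card_cartesian_product)
  also have "card (I \<union> B) = card I + card B"
    using B fin finB by (subst card_Un_disjoint) auto
  also have "card (K - B) = card K - card B"
    using B finB by (intro card_Diff_subset) auto
  also have "card I + card B + (card K - card B) = k + card T"
  proof -
    have "card B \<le> card K" using B fin by (intro card_mono) auto
    then show ?thesis using I K by simp
  qed
  finally show red: "card (?D Red) = k + card T" .
  have green: "card (?D Green) = k + card T"
    using U T finU fin by (simp, subst card_Un_disjoint) (auto simp: card_cartesian_product)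
  have "card (K \<union> T) = k + card T"
    using fin T(2) K(2) by (simp add: card_Un_disjoint Int_commute)
  then have blue: "card (?D Blue) = k + card T"
    using sum_card_hands[OF union disj] fin red green by simp
  have "\<forall>p q. card (?D p) = card (?D q)"
    using red green blue by (simp only: all_color)
  then show "?D \<in> barrucand_deals n"
    unfolding barrucand_deals_def mem_Collect_eq
    using union disj own K(1) T(1) by (intro exI[of _ "K \<union> T"] conjI) simp_all
  show "denominations (?D Red) = K"
    using I(1) B unfolding denominations_def by (auto simp: image_Un B_def)
  show "(\<Union>p. ?D p) = UNIV \<times> (K \<union> T)"
    by (rule union)
qed

lemma code_of_deal_of:
  assumes "(K, T, I, U) \<in> deal_codes n k"
  shows "code_of (deal_of (K, T, I, U)) = (K, T, I, U)"
proof -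
  let ?D = "deal_of (K, T, I, U)"
  from assms have T: "T \<inter> K = {}" and I: "I \<subseteq> K"
    and U: "U \<subseteq> {Red} \<times> (K \<union> T) \<union> {Blue} \<times> (K - I)"
    by (auto simp: deal_codes_def free_green_cards_def)
  have "snd ` ?D Red = K"
    using deal_of_in_deals(3)[OF assms] by (simp add: denominations_def)
  moreover have "snd ` (\<Union>p. ?D p) - K = T"
    unfolding deal_of_in_deals(4)[OF assms] snd_image_times using T by auto
  moreover have "{x. (Green, x) \<in> ?D Red \<and> (Blue, x) \<in> ?D Red} = I"
    using I U by auto
  moreover have "?D Green - {Blue} \<times> T = U"
    using U T by auto
  ultimately show ?thesis
    by (simp only: code_of_def Let_def)
qed

text \<open>Equal hand sizes enter here twice: red's hand yields \<open>card I = card T\<close>, and green's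
  hand yields \<open>card U = k\<close>.\<close>

lemma deal_of_code_of:
  assumes "D \<in> barrucand_deals n" "card (denominations (D Red)) = k"
  shows "code_of D \<in> deal_codes n k" and "deal_of (code_of D) = D"
proof -
  from assms(1) obtain S where S: "S \<subseteq> {1..n}" and union: "(\<Union>p. D p) = UNIV \<times> S"
    and disj: "disjoint_family D" and eq: "\<forall>p q. card (D p) = card (D q)"
    and own: "\<forall>p. \<forall>c \<in> D p. fst c \<noteq> p"
    by (auto simp: barrucand_deals_def)
  have mem: "x \<in> S \<longleftrightarrow> (a, x) \<in> D Red \<or> (a, x) \<in> D Green \<or> (a, x) \<in> D Blue" for a x
    using union by (auto simp: ex_color set_eq_iff)
  have own': "(a, x) \<notin> D a" for a x
    using own by force
  have dj: "D Red \<inter> D Green = {}" "D Red \<inter> D Blue = {}" "D Green \<inter> D Blue = {}"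
    using disj unfolding disjoint_family_on_def by auto
  have dj': "c \<in> D Red \<Longrightarrow> c \<notin> D Green" "c \<in> D Red \<Longrightarrow> c \<notin> D Blue" "c \<in> D Green \<Longrightarrow> c \<notin> D Blue" for c
    using dj by auto
  have finS: "finite S"
    using S by (rule finite_subset) simp
  define K where "K = snd ` D Red"
  define X where "X = {x. (Green, x) \<in> D Red}"
  define Y where "Y = {x. (Blue, x) \<in> D Red}"
  define U where "U = D Green - {Blue} \<times> (S - K)"
  have K: "K = X \<union> Y"
  proof (rule set_eqI)
    fix x
    have "x \<in> K \<longleftrightarrow> (\<exists>a. (a, x) \<in> D Red)"
      by (force simp: K_def)
    then show "x \<in> K \<longleftrightarrow> x \<in> X \<union> Y"
      using own'[of Red] by (auto simp: ex_color X_def Y_def)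
  qed
  have KS: "K \<subseteq> S"
    unfolding K X_def Y_def using mem by auto
  have "snd ` (\<Union>p. D p) = S"
    unfolding union by force
  then have code: "code_of D = (K, S - K, X \<inter> Y, U)"
    unfolding code_of_def by (auto simp: Let_def K_def U_def X_def Y_def)
  have fin: "finite K" "finite X" "finite Y"
    using finite_subset[OF KS finS] K by simp_all
  have card: "card (D p) = card S" for p
  proof -
    have "card (D Red) + card (D Green) + card (D Blue) = 3 * card (D p)"
      using eq[rule_format, of Red p] eq[rule_format, of Green p] eq[rule_format, of Blue p]
      by linarith
    then show ?thesis
      using sum_card_hands[OF union disj finS] by simp
  qed
  have cardK: "card K = k"
    using assms(2) by (simp add: K_def denominations_def)
  have cardT: "card (S - K) = card S - k"
    using KS fin(1) cardK by (simp add: card_Diff_subset)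
  have le: "k \<le> card S"
    using KS finS cardK card_mono by blast
  have "D Red = {Green} \<times> X \<union> {Blue} \<times> Y"
  proof (rule set_eqI)
    fix c show "c \<in> D Red \<longleftrightarrow> c \<in> {Green} \<times> X \<union> {Blue} \<times> Y"
      using own'[of Red] by (cases c; cases "fst c") (auto simp: X_def Y_def)
  qed
  then have "card (D Red) = card X + card Y"
    using fin by (simp, subst card_Un_disjoint) (auto simp: card_cartesian_product)
  also have "\<dots> = card K + card (X \<inter> Y)"
    unfolding K by (rule card_Un_Int) (use fin in auto)
  finally have cardI: "card (X \<inter> Y) = card (S - K)"
    using card cardK cardT by simp
  have "{Blue} \<times> (S - K) \<subseteq> D Green"
    using mem own'[of Blue] unfolding K Y_def by blast
  then have cardU: "card U = k"
    unfolding U_def using finS card[of Green] cardT le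
    by (subst card_Diff_subset) (auto simp: card_cartesian_product)
  have Usub: "U \<subseteq> free_green_cards K (S - K) (X \<inter> Y)"
  proof
    fix c assume c: "c \<in> U"
    obtain a x where ax: "c = (a, x)" by (cases c)
    have "(a, x) \<in> D Green" using c ax by (simp add: U_def)
    then show "c \<in> free_green_cards K (S - K) (X \<inter> Y)"
      using c ax own'[of Green] mem dj'(1) KS
      by (cases a) (auto simp: U_def free_green_cards_def Y_def)
  qed
  show "code_of D \<in> deal_codes n k"
    unfolding code deal_codes_def using S KS cardK cardI cardU Usub K by auto
  have blueU: "(Blue, x) \<in> U \<longleftrightarrow> x \<in> K \<and> x \<notin> Y" for x
    using mem[of x Blue] own'[of Blue x] KS dj'(1) unfolding U_def Y_def by auto
  have redU: "(Red, x) \<in> U \<longleftrightarrow> (Red, x) \<in> D Green" for x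
    unfolding U_def by auto
  have greenU: "(Green, x) \<notin> U" for x
    using own'[of Green x] unfolding U_def by auto
  show "deal_of (code_of D) = D"
  proof (rule ext, rule set_eqI)
    fix p :: color and c :: playing_card
    obtain a x where c: "c = (a, x)" by (cases c)
    show "c \<in> deal_of (code_of D) p \<longleftrightarrow> c \<in> D p"
      unfolding code c
      by (cases p; cases a; simp add: blueU redU greenU own' K X_def Y_def;
          use mem[of x Red] mem[of x Green] mem[of x Blue] own'[of _ x]
            dj'[of "(Red, x)"] dj'[of "(Green, x)"] dj'[of "(Blue, x)"] in blast)
  qed
qed

lemma bij_betw_deal_of:
  "bij_betw deal_of (deal_codes n k)
     {D \<in> barrucand_deals n. card (denominations (D Red)) = k}"
proof (rule bij_betw_byWitness[where f' = code_of])
  show "\<forall>c\<in>deal_codes n k. code_of (deal_of c) = c"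
    using code_of_deal_of by fast
  show "\<forall>D\<in>{D \<in> barrucand_deals n. card (denominations (D Red)) = k}. deal_of (code_of D) = D"
    using deal_of_code_of(2) by blast
  show "code_of ` {D \<in> barrucand_deals n. card (denominations (D Red)) = k} \<subseteq> deal_codes n k"
    using deal_of_code_of(1) by blast
  show "deal_of ` deal_codes n k \<subseteq> {D \<in> barrucand_deals n. card (denominations (D Red)) = k}"
  proof (rule image_subsetI)
    fix c assume c: "c \<in> deal_codes n k"
    obtain K T I U where "c = (K, T, I, U)" by (cases c)
    moreover from this c have "card K = k"
      by (simp add: deal_codes_def)
    ultimately show "deal_of c \<in> {D \<in> barrucand_deals n. card (denominations (D Red)) = k}"
      using c deal_of_in_deals[of K T I U n k] by (simp del: deal_of.simps)
  qed
qed

section \<open>Counting the deals\<close>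

lemma finite_free_green_cards:
  "finite K \<Longrightarrow> finite T \<Longrightarrow> finite (free_green_cards K T I)"
  by (simp add: free_green_cards_def)

lemma card_free_green_hands:
  assumes "finite K" "finite T" "T \<inter> K = {}" "I \<subseteq> K" "card I = card T"
  shows "card {U. U \<subseteq> free_green_cards K T I \<and> card U = card K} = (2 * card K) choose card K"
proof -
  have fin: "finite (free_green_cards K T I)" "finite I"
    by (rule finite_free_green_cards[OF assms(1,2)], rule finite_subset[OF assms(4,1)])
  have "card (free_green_cards K T I) = card (K \<union> T) + card (K - I)"
    unfolding free_green_cards_def using assms
    by (subst card_Un_disjoint) (auto simp: card_cartesian_product)
  also have "\<dots> = card K + card T + (card K - card I)"
    using assms fin by (simp add: card_Un_disjoint card_Diff_subset Int_commute)
  also have "\<dots> = 2 * card K"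
    using assms card_mono[of K I] by simp
  finally show ?thesis
    using n_subsets[OF fin(1)] by simp
qed

lemma sum_over_Sigma:
  fixes g :: "'a \<times> 'b \<Rightarrow> nat"
  assumes "finite A" "\<And>x. x \<in> A \<Longrightarrow> finite (B x)"
  shows "(\<Sum>z\<in>Sigma A B. g z) = (\<Sum>x\<in>A. \<Sum>y\<in>B x. g (x, y))"
  using assms by (simp add: sum.Sigma)

lemma finite_deal_codes: "finite (deal_codes n k)"
  unfolding deal_codes_def free_green_cards_def
proof (intro finite_SigmaI)
  show "finite {K. K \<subseteq> {1..n} \<and> card K = k}"
    by simp
next
  fix K assume K: "K \<in> {K. K \<subseteq> {1..n} \<and> card K = k}"
  then have fK: "finite K" using finite_subset by blast
  show "finite (Pow ({1..n} - K))" by simp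
  fix T assume T: "T \<in> Pow ({1..n} - K)"
  then have fT: "finite T" using finite_subset by blast
  show "finite {I. I \<subseteq> K \<and> card I = card T}"
    using fK by simp
  fix I
  show "finite {U. U \<subseteq> {Red} \<times> (K \<union> T) \<union> {Blue} \<times> (K - I) \<and> card U = k}"
    using fK fT by simp
qed

text \<open>The number of pairs \<open>(I, U)\<close> over given \<open>K\<close> and \<open>T\<close> depends on \<open>T\<close> through its size only, so
  any weight in \<open>card T\<close> can be carried along.  Here \<open>card T\<close> will determine the hand size \<open>k + card T\<close>
  and with it the number of indices paired with the deal.\<close>

lemma weighted_count_deal_codes:
  fixes w :: "nat \<Rightarrow> nat"
  assumes "k \<le> n"
  shows "(\<Sum>(K, T, I, U)\<in>deal_codes n k. w (card T))
       = (n choose k) * (\<Sum>t\<le>k. ((n - k) choose t) * (((2 * k) choose k) * (k choose t) * w t))"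
proof -
  let ?Ks = "{K. K \<subseteq> {1..n} \<and> card K = k}"
  have "(\<Sum>(K, T, I, U)\<in>deal_codes n k. w (card T))
      = (\<Sum>K\<in>?Ks. \<Sum>T\<in>Pow ({1..n} - K). \<Sum>I\<in>{I. I \<subseteq> K \<and> card I = card T}.
          \<Sum>U\<in>{U. U \<subseteq> free_green_cards K T I \<and> card U = k}. w (card T))"
    unfolding deal_codes_def
  proof (rule trans[OF sum_over_Sigma], goal_cases)
    case 3
    show ?case
    proof (rule sum.cong[OF refl], rule trans[OF sum_over_Sigma], goal_cases)
      case (3 K)
      then have "finite K" using finite_subset by blast
      show ?case
      proof (rule sum.cong[OF refl], rule trans[OF sum_over_Sigma], goal_cases)
        case (2 T I)
        then show ?case
          using finite_free_green_cards[of K T I] \<open>finite K\<close> finite_subset[of T "{1..n} - K"] by simp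
      qed (use \<open>finite K\<close> in simp_all)
    next
      case (2 K T)
      then have "finite K" "finite T" using finite_subset by blast+
      then show ?case
        by (intro finite_SigmaI) (simp_all add: finite_free_green_cards)
    qed simp
  next
    case (2 K)
    then have "finite K" using finite_subset by blast
    then show ?case
      by (intro finite_SigmaI) (simp_all add: finite_free_green_cards finite_subset[of _ "{1..n} - K"])
  qed simp
  also have "\<dots> = (\<Sum>K\<in>?Ks. \<Sum>t\<le>k. ((n - k) choose t) * (((2 * k) choose k) * (k choose t) * w t))"
  proof (rule sum.cong[OF refl])
    fix K assume "K \<in> ?Ks"
    then have K: "K \<subseteq> {1..n}" "card K = k" by auto
    then have fK: "finite K" using finite_subset by blast
    have cT: "card ({1..n} - K) = n - k"
      using K fK by (simp add: card_Diff_subset)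
    have "(\<Sum>T\<in>Pow ({1..n} - K). \<Sum>I\<in>{I. I \<subseteq> K \<and> card I = card T}.
            \<Sum>U\<in>{U. U \<subseteq> free_green_cards K T I \<and> card U = k}. w (card T))
        = (\<Sum>T\<in>Pow ({1..n} - K). ((2 * k) choose k) * (k choose card T) * w (card T))"
    proof (rule sum.cong[OF refl])
      fix T assume T: "T \<in> Pow ({1..n} - K)"
      then have fT: "finite T" using finite_subset by blast
      have "(\<Sum>I\<in>{I. I \<subseteq> K \<and> card I = card T}.
              \<Sum>U\<in>{U. U \<subseteq> free_green_cards K T I \<and> card U = k}. w (card T))
          = (\<Sum>I\<in>{I. I \<subseteq> K \<and> card I = card T}. ((2 * k) choose k) * w (card T))"
        using card_free_green_hands[OF fK fT] T K(2) by (intro sum.cong refl) auto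
      then show "(\<Sum>I\<in>{I. I \<subseteq> K \<and> card I = card T}.
              \<Sum>U\<in>{U. U \<subseteq> free_green_cards K T I \<and> card U = k}. w (card T))
          = ((2 * k) choose k) * (k choose card T) * w (card T)"
        using n_subsets[OF fK, of "card T"] K(2) by simp
    qed
    also have "\<dots> = (\<Sum>t\<le>n - k. ((n - k) choose t) * (((2 * k) choose k) * (k choose t) * w t))"
      using sum_Pow_card[of "{1..n} - K" "\<lambda>t. ((2 * k) choose k) * (k choose t) * w t"] cT by simp
    also have "\<dots> = (\<Sum>t\<le>k. ((n - k) choose t) * (((2 * k) choose k) * (k choose t) * w t))"
      \<comment> \<open>The terms with \<open>t > min k (n - k)\<close> vanish.\<close>
      by (rule sum.mono_neutral_cong) auto
    finally show "(\<Sum>T\<in>Pow ({1..n} - K). \<Sum>I\<in>{I. I \<subseteq> K \<and> card I = card T}.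
            \<Sum>U\<in>{U. U \<subseteq> free_green_cards K T I \<and> card U = k}. w (card T))
        = (\<Sum>t\<le>k. ((n - k) choose t) * (((2 * k) choose k) * (k choose t) * w t))" .
  qed
  also have "\<dots> = (n choose k) * (\<Sum>t\<le>k. ((n - k) choose t) * (((2 * k) choose k) * (k choose t) * w t))"
    using n_subsets[of "{1..n}" k] by simp
  finally show ?thesis .
qed

lemma deal_pairs_fibre:
  assumes "k \<le> n"
  shows "finite {(D, i) \<in> deal_pairs n. card (denominations (D Red)) = k}" (is "finite ?P")
    and "card {(D, i) \<in> deal_pairs n. card (denominations (D Red)) = k}
           = (n choose k)\<^sup>2 * ((n + k) choose k)\<^sup>2"
proof -
  let ?Ds = "{D \<in> barrucand_deals n. card (denominations (D Red)) = k}"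
  let ?w = "\<lambda>m. (n + m) choose m"
  have P: "?P = (SIGMA D:?Ds. {1..?w (card (D Red))})"
    by (auto simp: deal_pairs_def)
  have finDs: "finite ?Ds"
    using bij_betw_finite[OF bij_betw_deal_of] finite_deal_codes by blast
  show "finite ?P"
    unfolding P by (rule finite_SigmaI[OF finDs]) simp
  have "card ?P = (\<Sum>D\<in>?Ds. ?w (card (D Red)))"
    unfolding P using finDs by simp
  also have "\<dots> = (\<Sum>c\<in>deal_codes n k. ?w (card (deal_of c Red)))"
    by (rule sum.reindex_bij_betw[OF bij_betw_deal_of, symmetric])
  also have "\<dots> = (\<Sum>(K, T, I, U)\<in>deal_codes n k. ?w (k + card T))"
    by (rule sum.cong[OF refl]) (auto simp: deal_of_in_deals(2) simp del: deal_of.simps)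
  also have "\<dots> = (n choose k) *
      (\<Sum>t\<le>k. ((n - k) choose t) * (((2 * k) choose k) * (k choose t) * ?w (k + t)))"
    using weighted_count_deal_codes[OF assms, of "\<lambda>t. ?w (k + t)"] .
  also have "\<dots> = (n choose k) *
      (\<Sum>t\<le>k. ((n + k) choose k) *
        (((n - k) choose t) * ((2 * k) choose (k - t)) * ((n + k + t) choose t)))"
  proof -
    have "((n - k) choose t) * (((2 * k) choose k) * (k choose t) * ?w (k + t))
        = ((n + k) choose k) *
          (((n - k) choose t) * ((2 * k) choose (k - t)) * ((n + k + t) choose t))"
      if "t \<le> k" for t
      using central_binomial_exchange[OF that, of n] by (simp add: add.assoc[symmetric])
    then show ?thesis
      by (intro arg_cong[where f = "(*) (n choose k)"] sum.cong refl) (simp only: atMost_iff)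
  qed
  also have "\<dots> = (n choose k)\<^sup>2 * ((n + k) choose k)\<^sup>2"
    by (simp add: saalschuetz_binomial[OF assms] power2_eq_square flip: sum_distrib_left)
  finally show "card ?P = (n choose k)\<^sup>2 * ((n + k) choose k)\<^sup>2" .
qed

lemma card_denominations_le:
  assumes "D \<in> barrucand_deals n"
  shows "card (denominations (D p)) \<le> n"
proof -
  from assms obtain S where S: "S \<subseteq> {1..n}" "(\<Union>p. D p) = UNIV \<times> S"
    by (auto simp: barrucand_deals_def)
  then have "D p \<subseteq> UNIV \<times> S"
    by blast
  then have "denominations (D p) \<subseteq> {1..n}"
    using S(1) unfolding denominations_def by auto
  then show ?thesis
    using card_mono[of "{1..n}"] by simp
qed

theorem proposition2:
  fixes n :: nat
  shows "(\<forall>k\<le>n. card {(D, i) \<in> deal_pairs n. card (denominations (D Red)) = k}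
                  = (n choose k)\<^sup>2 * ((n + k) choose k)\<^sup>2) \<and>
         card (deal_pairs n) = (\<Sum>k=0..n. (n choose k)\<^sup>2 * ((n + k) choose k)\<^sup>2)"
proof
  show "\<forall>k\<le>n. card {(D, i) \<in> deal_pairs n. card (denominations (D Red)) = k}
                  = (n choose k)\<^sup>2 * ((n + k) choose k)\<^sup>2"
    using deal_pairs_fibre(2) by blast
  let ?P = "\<lambda>k. {(D, i) \<in> deal_pairs n. card (denominations (D Red)) = k}"
  have "deal_pairs n = (\<Union>k\<in>{0..n}. ?P k)"
    using card_denominations_le by (auto simp: deal_pairs_def)
  then have "card (deal_pairs n) = card (\<Union>k\<in>{0..n}. ?P k)"
    by (rule arg_cong)
  also have "\<dots> = (\<Sum>k=0..n. card (?P k))"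
    by (rule card_UN_disjoint) (use deal_pairs_fibre(1) in auto)
  also have "\<dots> = (\<Sum>k=0..n. (n choose k)\<^sup>2 * ((n + k) choose k)\<^sup>2)"
    using deal_pairs_fibre(2) by simp
  finally show "card (deal_pairs n) = (\<Sum>k=0..n. (n choose k)\<^sup>2 * ((n + k) choose k)\<^sup>2)" .
qed

end
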